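(* Let $\alpha\ge4$ and $0<K<\infty$. For any $\varepsilon\in(0,1)$ there exists a constant $C>0$ depending only on $\alpha$, $K$ and $\varepsilon$ such that, for all integers $n\ge50$ and $p\ge1$, there exists a test $\phi_{\mathcal{P},\mathrm{multi}}^{\mathrm{MoM}}$ that satisfies $$\mathcal{R}_{\mathcal{P},\mathrm{multi}}(\rho,\phi_{\mathcal{P},\mathrm{multi}}^{\mathrm{MoM}})\le\varepsilon$$ as long as $\rho^2\ge C\sqrt p\,\log(n)$.
   Context: Notation: $[m]=\{1,\dots,m\}$; $\log$ is the natural logarithm. Model: $X=\theta+E\in\mathbb{R}^{p\times n}$, with deterministic $\theta$ and random $E\sim P_e$; $\theta_t\in\mathbb{R}^p$ denotes the $t$-th column. $\mathbb{E}_{\theta,P_e}$ is expectation under the law of $X$. A test is a measurable map $\phi:\mathbb{R}^{p\times n}\to\{0,1\}$. Null space: $\Theta_0(p,n)=\{\theta:\exists\mu\in\mathbb{R}^p,\ \theta_t=\mu\ \forall t\in[n]\}$. Alternative space: $\Theta_{\mathrm{multi}}(p,n,\rho)=\bigcup_{k\ge1}\bigcup_{1\le\tau_1<\dots<\tau_k\le n-1}\Theta^{(\tau_1,\dots,\tau_k)}(p,n,\rho)$, where, with $\tau_0=0$ and $\tau_{k+1}=n$, $\Theta^{(\tau_1,\dots,\tau_k)}(p,n,\rho)$ is the set of $\theta$ for which there are $\mu_1,\dots,\mu_{k+1}\in\mathbb{R}^p$ with $\theta_{\tau_{i-1}+1}=\dots=\theta_{\tau_i}=\mu_i$ for all $i\in[k+1]$,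 and there exists $i\in[k]$ with $\Delta_i\ge4\log(n)$ and $\kappa_i^2\Delta_i\ge\rho^2$, where $\Delta_i=\min\{\tau_i-\tau_{i-1},\tau_{i+1}-\tau_i\}$ and $\kappa_i=\|\mu_{i+1}-\mu_i\|_2$. Noise class: $\mathcal{P}_{\alpha,K}$ is the class of distributions of real random variables $W$ with $\mathbb{E}W=0$, $\mathbb{E}W^2=1$, $\mathbb{E}|W/K|^\alpha\le1$. $\mathcal{P}_{\alpha,K}^{\otimes}$ is the class of joint distributions of $E$ with mutually independent entries, each entry having a (possibly different) distribution in $\mathcal{P}_{\alpha,K}$. Worst-case testing error: $$\mathcal{R}_{\mathcal{P},\mathrm{multi}}(\rho,\phi)=\sup_{P_e\in\mathcal{P}_{\alpha,K}^{\otimes}}\sup_{\theta\in\Theta_0(p,n)}\mathbb{E}_{\theta,P_e}(\phi)+\sup_{P_e\in\mathcal{P}_{\alpha,K}^{\otimes}}\sup_{\theta\in\Theta_{\mathrm{multi}}(p,n,\rho)}\mathbb{E}_{\theta,P_e}(1-\phi).$$ *)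

theory Defs
  imports "HOL-Probability.Probability"
begin

text \<open>
  A real \<open>p \<times> n\<close> matrix is a function \<open>nat \<times> nat \<Rightarrow> real\<close> that is extensional on the index set
  \<open>{1..p} \<times> {1..n}\<close>; the pair \<open>(j, t)\<close> is (row, column). The dimensions have to be ordinary
  natural numbers because the constant in the main statement is uniform in them.
  As the index set is finite, the product sigma-algebra is the Borel sigma-algebra on matrices.
\<close>

definition entries :: "nat \<Rightarrow> nat \<Rightarrow> (nat \<times> nat) set" where
  "entries p n = {1..p} \<times> {1..n}"

definition matrix_space :: "nat \<Rightarrow> nat \<Rightarrow> (nat \<times> nat \<Rightarrow> real) measure" where
  "matrix_space p n = (\<Pi>\<^sub>M e\<in>entries p n. borel)"

definition matrices :: "nat \<Rightarrow> nat \<Rightarrow> (nat \<times> nat \<Rightarrow> real) set" where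
  "matrices p n = space (matrix_space p n)"

definition Theta_null :: "nat \<Rightarrow> nat \<Rightarrow> (nat \<times> nat \<Rightarrow> real) set" where
  "Theta_null p n =
     {\<theta> \<in> matrices p n. \<exists>\<mu> :: nat \<Rightarrow> real. \<forall>t\<in>{1..n}. \<forall>j\<in>{1..p}. \<theta> (j, t) = \<mu> j}"

text \<open>
  Change points are functions \<open>\<tau>\<close> of which only the values at \<open>0, \<dots>, k + 1\<close> matter; the
  boundary conventions \<open>\<tau> 0 = 0\<close> and \<open>\<tau> (k + 1) = n\<close> are part of the definition.
\<close>

definition change_points :: "nat \<Rightarrow> nat \<Rightarrow> (nat \<Rightarrow> nat) set" where
  "change_points n k =
     {\<tau>. \<tau> 0 = 0 \<and> \<tau> (k + 1) = n \<and>
         1 \<le> \<tau> 1 \<and> strict_mono_on {1..k} \<tau> \<and> \<tau> k \<le> n - 1}"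

definition spacing :: "(nat \<Rightarrow> nat) \<Rightarrow> nat \<Rightarrow> nat" where
  "spacing \<tau> i = min (\<tau> i - \<tau> (i - 1)) (\<tau> (i + 1) - \<tau> i)"

text \<open>Here \<open>\<mu> i\<close> is the \<open>i\<close>-th mean vector, and only its coordinates \<open>1, \<dots>, p\<close> matter.\<close>

definition jump :: "nat \<Rightarrow> (nat \<Rightarrow> nat \<Rightarrow> real) \<Rightarrow> nat \<Rightarrow> real" where
  "jump p \<mu> i = L2_set (\<lambda>j. \<mu> (i + 1) j - \<mu> i j) {1..p}"

definition Theta_at ::
    "nat \<Rightarrow> nat \<Rightarrow> real \<Rightarrow> nat \<Rightarrow> (nat \<Rightarrow> nat) \<Rightarrow> (nat \<times> nat \<Rightarrow> real) set" where
  "Theta_at p n \<rho> k \<tau> =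
     {\<theta> \<in> matrices p n. \<exists>\<mu> :: nat \<Rightarrow> nat \<Rightarrow> real.
        (\<forall>i\<in>{1..k + 1}. \<forall>t\<in>{\<tau> (i - 1) + 1..\<tau> i}. \<forall>j\<in>{1..p}. \<theta> (j, t) = \<mu> i j) \<and>
        (\<exists>i\<in>{1..k}. real (spacing \<tau> i) \<ge> 4 * ln (real n) \<and>
                    (jump p \<mu> i)\<^sup>2 * real (spacing \<tau> i) \<ge> \<rho>\<^sup>2)}"

definition Theta_multi :: "nat \<Rightarrow> nat \<Rightarrow> real \<Rightarrow> (nat \<times> nat \<Rightarrow> real) set" where
  "Theta_multi p n \<rho> = (\<Union>k\<in>{1..}. \<Union>\<tau>\<in>change_points n k. Theta_at p n \<rho> k \<tau>)"

text \<open>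
  Integrability is demanded explicitly since the Bochner integral of a non-integrable
  function is zero.
\<close>

definition noise_class :: "real \<Rightarrow> real \<Rightarrow> real measure set" where
  "noise_class \<alpha> K =
     {D. prob_space D \<and> sets D = sets borel \<and>
         integrable D (\<lambda>w. w) \<and> (LINT w|D. w) = 0 \<and>
         integrable D (\<lambda>w. w\<^sup>2) \<and> (LINT w|D. w\<^sup>2) = 1 \<and>
         integrable D (\<lambda>w. \<bar>w / K\<bar> powr \<alpha>) \<and> (LINT w|D. \<bar>w / K\<bar> powr \<alpha>) \<le> 1}"

definition noise_laws ::
    "nat \<Rightarrow> nat \<Rightarrow> real \<Rightarrow> real \<Rightarrow> (nat \<times> nat \<Rightarrow> real) measure set" where
  "noise_laws p n \<alpha> K =
     {P. prob_space P \<and> sets P = sets (matrix_space p n) \<and>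
         prob_space.indep_vars P (\<lambda>_. borel) (\<lambda>e E. E e) (entries p n) \<and>
         (\<forall>e\<in>entries p n. distr P borel (\<lambda>E. E e) \<in> noise_class \<alpha> K)}"

definition data_law ::
    "nat \<Rightarrow> nat \<Rightarrow> (nat \<times> nat \<Rightarrow> real) \<Rightarrow> (nat \<times> nat \<Rightarrow> real) measure
       \<Rightarrow> (nat \<times> nat \<Rightarrow> real) measure" where
  "data_law p n \<theta> P = distr P (matrix_space p n) (\<lambda>E. \<lambda>e\<in>entries p n. \<theta> e + E e)"

definition tests :: "nat \<Rightarrow> nat \<Rightarrow> ((nat \<times> nat \<Rightarrow> real) \<Rightarrow> real) set" where
  "tests p n = measurable (matrix_space p n) (count_space {0, 1})"

text \<open>
  The suprema are taken in \<^typ>\<open>ennreal\<close>, so that the supremum over an empty class (there is no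
  admissible noise if \<open>K < 1\<close>) is zero. The expectations lie in \<open>[0, 1]\<close>, so the
  embedding \<^const>\<open>ennreal\<close> loses nothing.
\<close>

definition testing_error ::
    "nat \<Rightarrow> nat \<Rightarrow> real \<Rightarrow> real \<Rightarrow> real \<Rightarrow> ((nat \<times> nat \<Rightarrow> real) \<Rightarrow> real) \<Rightarrow> ennreal" where
  "testing_error p n \<alpha> K \<rho> \<phi> =
     (SUP P\<in>noise_laws p n \<alpha> K. SUP \<theta>\<in>Theta_null p n.
        ennreal (LINT X|data_law p n \<theta> P. \<phi> X)) +
     (SUP P\<in>noise_laws p n \<alpha> K. SUP \<theta>\<in>Theta_multi p n \<rho>.
        ennreal (LINT X|data_law p n \<theta> P. 1 - \<phi> X))"

end

theory Submission
  imports Defs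
begin

text \<open>
  Around a candidate change point \<open>v\<close>, the columns at distance at most \<open>2 G m\<close> from \<open>v\<close> are cut into
  \<open>2 G\<close> symmetric blocks of \<open>m\<close> columns on each side, with \<open>G = \<lceil>ln n\<rceil>\<close>. The difference of the sums
  over the two sides of a block estimates \<open>m\<close> times the jump; the inner product of two such
  independent vectors is an estimate of \<open>m\<^sup>2\<close> times the squared jump which is unbiased without any
  knowledge of the noise, and whose variance \<open>4 m (m\<^sup>2 |\<delta>|\<^sup>2) + 4 m\<^sup>2 p\<close> involves second moments
  only. By Chebyshev's inequality each of the \<open>G\<close> inner products is misleading with a small constant
  probability \<open>q\<close>; as they are independent, half of them are misleading with probability at most
  \<open>(2 sqrt q)^G\<close>. For small \<open>q\<close> this is a large negative power of \<open>n\<close>, so under the null hypothesis a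
  union bound over all \<open>(v, m)\<close> is affordable, while under the alternative the single window at the
  true change point suffices. The condition that the spacing be at least \<open>4 ln n\<close> makes \<open>m \<ge> 1\<close> possible.
\<close>

section \<open>Tail bounds from second moments\<close>

context prob_space
begin

lemma indep_vars_sum_second_moment:
  fixes X :: "'i \<Rightarrow> 'a \<Rightarrow> real"
  assumes "finite I" "indep_vars (\<lambda>_. borel) X I"
    and "\<And>i. i \<in> I \<Longrightarrow> integrable M (\<lambda>\<omega>. (X i \<omega>)\<^sup>2)"
    and "\<And>i. i \<in> I \<Longrightarrow> expectation (X i) = 0"
  shows "integrable M (\<lambda>\<omega>. (\<Sum>i\<in>I. X i \<omega>)\<^sup>2) \<and> expectation (\<lambda>\<omega>. \<Sum>i\<in>I. X i \<omega>) = 0 \<and>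
    expectation (\<lambda>\<omega>. (\<Sum>i\<in>I. X i \<omega>)\<^sup>2) = (\<Sum>i\<in>I. expectation (\<lambda>\<omega>. (X i \<omega>)\<^sup>2))"
  using assms
proof (induction I rule: finite_induct)
  case empty
  then show ?case by simp
next
  case (insert i I)
  let ?S = "\<lambda>\<omega>. \<Sum>i\<in>I. X i \<omega>"
  have IH: "integrable M (\<lambda>\<omega>. (?S \<omega>)\<^sup>2)" "expectation ?S = 0"
    "expectation (\<lambda>\<omega>. (?S \<omega>)\<^sup>2) = (\<Sum>i\<in>I. expectation (\<lambda>\<omega>. (X i \<omega>)\<^sup>2))"
    using insert.IH[OF indep_vars_subset[OF insert.prems(1)]] insert.prems by auto
  have rv: "random_variable borel (X j)" if "j \<in> insert i I" for j
    using insert.prems(1) that by (auto simp: indep_vars_def)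
  have int: "integrable M (X i)" "integrable M ?S"
    using square_integrable_imp_integrable[OF rv insert.prems(2)]
    by (auto intro!: Bochner_Integration.integrable_sum)
  have sq: "integrable M (\<lambda>\<omega>. (X i \<omega>)\<^sup>2)" and mean: "expectation (X i) = 0"
    using insert.prems by auto
  have ind: "indep_var borel (X i) borel ?S"
    using indep_vars_sum[OF insert.hyps(1,2) insert.prems(1)] .
  have cross: "integrable M (\<lambda>\<omega>. X i \<omega> * ?S \<omega>)" "expectation (\<lambda>\<omega>. X i \<omega> * ?S \<omega>) = 0"
    using indep_var_integrable[OF ind int] indep_var_lebesgue_integral[OF ind int] mean by auto
  have eq: "(\<lambda>\<omega>. (\<Sum>j\<in>insert i I. X j \<omega>)\<^sup>2) =
      (\<lambda>\<omega>. (X i \<omega>)\<^sup>2 + (?S \<omega>)\<^sup>2 + 2 * (X i \<omega> * ?S \<omega>))"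
    using insert.hyps by (simp add: power2_sum algebra_simps)
  have "expectation (\<lambda>\<omega>. \<Sum>j\<in>insert i I. X j \<omega>) = expectation (X i) + expectation ?S"
    using insert.hyps int by simp
  moreover have "expectation (\<lambda>\<omega>. (X i \<omega>)\<^sup>2 + (?S \<omega>)\<^sup>2 + 2 * (X i \<omega> * ?S \<omega>)) =
      expectation (\<lambda>\<omega>. (X i \<omega>)\<^sup>2) + expectation (\<lambda>\<omega>. (?S \<omega>)\<^sup>2)"
    using sq IH(1) cross by simp
  moreover have "integrable M (\<lambda>\<omega>. (X i \<omega>)\<^sup>2 + (?S \<omega>)\<^sup>2 + 2 * (X i \<omega> * ?S \<omega>))"
    using sq IH(1) cross by simp
  ultimately show ?case
    using IH mean insert.hyps unfolding eq by simp
qed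

lemma signed_sum_moments:
  fixes X :: "'i \<Rightarrow> 'a \<Rightarrow> real" and u :: real
  assumes "finite A" and ind: "indep_vars (\<lambda>_. borel) X A"
    and sq: "\<And>i. i \<in> A \<Longrightarrow> integrable M (\<lambda>\<omega>. (X i \<omega>)\<^sup>2)"
    and mean: "\<And>i. i \<in> A \<Longrightarrow> expectation (X i) = 0"
    and var: "\<And>i. i \<in> A \<Longrightarrow> expectation (\<lambda>\<omega>. (X i \<omega>)\<^sup>2) = 1"
    and s: "\<And>i. i \<in> A \<Longrightarrow> \<bar>s i\<bar> = 1"
  defines "P \<equiv> \<lambda>\<omega>. u + (\<Sum>i\<in>A. s i * X i \<omega>)"
  shows "integrable M (\<lambda>\<omega>. (P \<omega>)\<^sup>2)" "integrable M P" "expectation P = u"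
    "expectation (\<lambda>\<omega>. (P \<omega>)\<^sup>2) = u\<^sup>2 + card A"
proof -
  let ?S = "\<lambda>\<omega>. \<Sum>i\<in>A. s i * X i \<omega>"
  have s2: "(s i)\<^sup>2 = 1" if "i \<in> A" for i
    using s[OF that] by (metis abs_1 power2_abs power_one)
  have rv: "random_variable borel (X i)" if "i \<in> A" for i
    using ind that by (auto simp: indep_vars_def)
  have "indep_vars (\<lambda>_. borel) (\<lambda>i \<omega>. s i * X i \<omega>) A"
    using indep_vars_compose2[OF ind, where Y = "\<lambda>i x. s i * x" and N = "\<lambda>_. borel"] by simp
  from indep_vars_sum_second_moment[OF \<open>finite A\<close> this]
  have S: "integrable M (\<lambda>\<omega>. (?S \<omega>)\<^sup>2)" "expectation ?S = 0"
    "expectation (\<lambda>\<omega>. (?S \<omega>)\<^sup>2) = card A"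
    using sq mean var s2 by (auto simp: power_mult_distrib)
  have intS: "integrable M ?S"
    using square_integrable_imp_integrable[OF rv sq] by (auto intro!: Bochner_Integration.integrable_sum)
  have eq: "(\<lambda>\<omega>. (P \<omega>)\<^sup>2) = (\<lambda>\<omega>. u\<^sup>2 + (?S \<omega>)\<^sup>2 + 2 * u * ?S \<omega>)"
    by (simp add: P_def power2_sum)
  show "integrable M (\<lambda>\<omega>. (P \<omega>)\<^sup>2)" unfolding eq using S intS by simp
  show "integrable M P" "expectation P = u" unfolding P_def using S intS by (simp_all add: prob_space)
  show "expectation (\<lambda>\<omega>. (P \<omega>)\<^sup>2) = u\<^sup>2 + card A"
    unfolding eq using S intS by (simp add: prob_space)
qed

lemma product_of_signed_sums_moments:
  fixes X :: "'i \<Rightarrow> 'a \<Rightarrow> real" and u :: real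
  assumes fin: "finite A" "finite B" "A \<inter> B = {}" "card A = k" "card B = k"
    and ind: "indep_vars (\<lambda>_. borel) X (A \<union> B)"
    and sq: "\<And>i. i \<in> A \<union> B \<Longrightarrow> integrable M (\<lambda>\<omega>. (X i \<omega>)\<^sup>2)"
    and mean: "\<And>i. i \<in> A \<union> B \<Longrightarrow> expectation (X i) = 0"
    and var: "\<And>i. i \<in> A \<union> B \<Longrightarrow> expectation (\<lambda>\<omega>. (X i \<omega>)\<^sup>2) = 1"
    and s: "\<And>i. i \<in> A \<union> B \<Longrightarrow> \<bar>s i\<bar> = 1"
  defines "Z \<equiv> \<lambda>\<omega>. (u + (\<Sum>i\<in>A. s i * X i \<omega>)) * (u + (\<Sum>i\<in>B. s i * X i \<omega>)) - u\<^sup>2"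
  shows "integrable M (\<lambda>\<omega>. (Z \<omega>)\<^sup>2)" "expectation Z = 0"
    "expectation (\<lambda>\<omega>. (Z \<omega>)\<^sup>2) = 2 * real k * u\<^sup>2 + (real k)\<^sup>2"
proof -
  let ?P = "\<lambda>\<omega>. u + (\<Sum>i\<in>A. s i * X i \<omega>)" and ?Q = "\<lambda>\<omega>. u + (\<Sum>i\<in>B. s i * X i \<omega>)"
  let ?f = "\<lambda>D x. u + (\<Sum>i\<in>D. s i * x i)"
  have P: "integrable M (\<lambda>\<omega>. (?P \<omega>)\<^sup>2)" "integrable M ?P" "expectation ?P = u"
    "expectation (\<lambda>\<omega>. (?P \<omega>)\<^sup>2) = u\<^sup>2 + k"
    using signed_sum_moments[of A X s u] indep_vars_subset[OF ind, of A] assms by auto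
  have Q: "integrable M (\<lambda>\<omega>. (?Q \<omega>)\<^sup>2)" "integrable M ?Q" "expectation ?Q = u"
    "expectation (\<lambda>\<omega>. (?Q \<omega>)\<^sup>2) = u\<^sup>2 + k"
    using signed_sum_moments[of B X s u] indep_vars_subset[OF ind, of B] assms by auto
  have "indep_var borel (?f A \<circ> (\<lambda>\<omega>. \<lambda>i\<in>A. X i \<omega>)) borel (?f B \<circ> (\<lambda>\<omega>. \<lambda>i\<in>B. X i \<omega>))"
    by (rule indep_var_compose[OF indep_var_restrict[OF ind]]) (use fin in auto)
  then have PQ: "indep_var borel ?P borel ?Q"
    by (simp add: comp_def)
  then have "indep_var borel ((\<lambda>x. x\<^sup>2) \<circ> ?P) borel ((\<lambda>x. x\<^sup>2) \<circ> ?Q)"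
    by (rule indep_var_compose) auto
  then have PQ2: "indep_var borel (\<lambda>\<omega>. (?P \<omega>)\<^sup>2) borel (\<lambda>\<omega>. (?Q \<omega>)\<^sup>2)"
    by (simp add: comp_def)
  note R = indep_var_integrable[OF PQ P(2) Q(2)] indep_var_lebesgue_integral[OF PQ P(2) Q(2)]
    indep_var_integrable[OF PQ2 P(1) Q(1)] indep_var_lebesgue_integral[OF PQ2 P(1) Q(1)]
  have eq: "(\<lambda>\<omega>. (Z \<omega>)\<^sup>2) =
      (\<lambda>\<omega>. (?P \<omega>)\<^sup>2 * (?Q \<omega>)\<^sup>2 - 2 * u\<^sup>2 * (?P \<omega> * ?Q \<omega>) + u\<^sup>2 * u\<^sup>2)"
    unfolding Z_def by (intro ext) (simp add: power2_eq_square algebra_simps)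
  show "integrable M (\<lambda>\<omega>. (Z \<omega>)\<^sup>2)"
    unfolding eq using R by (intro Bochner_Integration.integrable_add Bochner_Integration.integrable_diff) auto
  show "expectation Z = 0"
    unfolding Z_def using R P Q by (simp add: prob_space power2_eq_square)
  have "expectation (\<lambda>\<omega>. (Z \<omega>)\<^sup>2) = (u\<^sup>2 + k) * (u\<^sup>2 + k) - 2 * u\<^sup>2 * (u * u) + u\<^sup>2 * u\<^sup>2"
    unfolding eq using R P(3,4) Q(3,4) by (simp add: prob_space)
  then show "expectation (\<lambda>\<omega>. (Z \<omega>)\<^sup>2) = 2 * real k * u\<^sup>2 + (real k)\<^sup>2"
    by (simp add: power2_eq_square algebra_simps)
qed

lemma inner_product_of_signed_sums_tail:
  fixes X :: "nat \<times> nat \<Rightarrow> 'a \<Rightarrow> real" and u :: "nat \<Rightarrow> real" and U :: real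
  assumes fin: "finite J" "finite A" "finite B" "A \<inter> B = {}" "card A = k" "card B = k"
    and ind: "indep_vars (\<lambda>_. borel) X (J \<times> (A \<union> B))"
    and sq: "\<And>i. i \<in> J \<times> (A \<union> B) \<Longrightarrow> integrable M (\<lambda>\<omega>. (X i \<omega>)\<^sup>2)"
    and mean: "\<And>i. i \<in> J \<times> (A \<union> B) \<Longrightarrow> expectation (X i) = 0"
    and var: "\<And>i. i \<in> J \<times> (A \<union> B) \<Longrightarrow> expectation (\<lambda>\<omega>. (X i \<omega>)\<^sup>2) = 1"
    and s: "\<And>t. t \<in> A \<union> B \<Longrightarrow> \<bar>s t\<bar> = 1" and "r > 0"
  defines "T \<equiv> \<lambda>\<omega>. \<Sum>j\<in>J. (u j + (\<Sum>t\<in>A. s t * X (j, t) \<omega>)) * (u j + (\<Sum>t\<in>B. s t * X (j, t) \<omega>))"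
  defines "U \<equiv> \<Sum>j\<in>J. (u j)\<^sup>2"
  shows "prob {\<omega>\<in>space M. \<bar>T \<omega> - U\<bar> \<ge> r} \<le> (2 * real k * U + (real k)\<^sup>2 * card J) / r\<^sup>2"
proof -
  define Z where "Z j \<omega> = (u j + (\<Sum>t\<in>A. s t * X (j, t) \<omega>)) * (u j + (\<Sum>t\<in>B. s t * X (j, t) \<omega>)) - (u j)\<^sup>2" for j \<omega>
  have Zmom: "integrable M (\<lambda>\<omega>. (Z j \<omega>)\<^sup>2)" "expectation (Z j) = 0"
    "expectation (\<lambda>\<omega>. (Z j \<omega>)\<^sup>2) = 2 * real k * (u j)\<^sup>2 + (real k)\<^sup>2" if "j \<in> J" for j
  proof -
    have *: "{j} \<times> A \<union> {j} \<times> B \<subseteq> J \<times> (A \<union> B)" using that by auto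
    have sum: "(\<Sum>t\<in>D. s t * X (j, t) \<omega>) = (\<Sum>e\<in>{j} \<times> D. s (snd e) * X e \<omega>)" for D \<omega>
      by (rule sum.reindex_bij_witness[of _ snd "Pair j"]) auto
    have "integrable M (\<lambda>\<omega>. (Z j \<omega>)\<^sup>2) \<and> expectation (Z j) = 0 \<and>
      expectation (\<lambda>\<omega>. (Z j \<omega>)\<^sup>2) = 2 * real k * (u j)\<^sup>2 + (real k)\<^sup>2"
      unfolding Z_def sum
      apply (intro conjI)
      apply (rule product_of_signed_sums_moments[OF _ _ _ _ _ indep_vars_subset[OF ind *]];
          use fin * sq mean var s in \<open>auto simp: card_cartesian_product\<close>)+
      done
    then show "integrable M (\<lambda>\<omega>. (Z j \<omega>)\<^sup>2)" "expectation (Z j) = 0"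
      "expectation (\<lambda>\<omega>. (Z j \<omega>)\<^sup>2) = 2 * real k * (u j)\<^sup>2 + (real k)\<^sup>2" by auto
  qed
  let ?f = "\<lambda>j x. (u j + (\<Sum>t\<in>A. s t * x (j, t))) * (u j + (\<Sum>t\<in>B. s t * x (j, t))) - (u j)\<^sup>2"
  have indr: "indep_vars (\<lambda>j. PiM ({j} \<times> (A \<union> B)) (\<lambda>_. borel))
      (\<lambda>j \<omega>. restrict (\<lambda>i. X i \<omega>) ({j} \<times> (A \<union> B))) J"
    by (rule indep_vars_restrict[OF ind]) (auto simp: disjoint_family_on_def)
  have "indep_vars (\<lambda>_. borel) (\<lambda>j \<omega>. ?f j (restrict (\<lambda>i. X i \<omega>) ({j} \<times> (A \<union> B)))) J"
    by (rule indep_vars_compose2[OF indr]) measurable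
  then have indZ: "indep_vars (\<lambda>_. borel) Z J"
    by (simp add: Z_def[abs_def])
  note S = indep_vars_sum_second_moment[OF fin(1) indZ Zmom(1,2)]
  have TZ: "T \<omega> - U = (\<Sum>j\<in>J. Z j \<omega>)" for \<omega>
    by (simp add: T_def U_def Z_def sum_subtractf)
  have rv: "random_variable borel (Z j)" if "j \<in> J" for j
    using indZ that by (auto simp: indep_vars_def)
  have "prob {\<omega>\<in>space M. \<bar>T \<omega> - U - expectation (\<lambda>\<omega>. \<Sum>j\<in>J. Z j \<omega>)\<bar> \<ge> r}
      \<le> variance (\<lambda>\<omega>. \<Sum>j\<in>J. Z j \<omega>) / r\<^sup>2"
    unfolding TZ by (rule Chebyshev_inequality) (use S rv \<open>r > 0\<close> in auto)
  moreover have "(\<Sum>j\<in>J. expectation (\<lambda>\<omega>. (Z j \<omega>)\<^sup>2)) = 2 * real k * U + (real k)\<^sup>2 * card J"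
    by (simp add: Zmom U_def sum.distrib sum_distrib_left)
  ultimately show ?thesis using S by simp
qed

lemma indep_vars_majority:
  fixes X :: "nat \<Rightarrow> 'a \<Rightarrow> real"
  assumes ind: "indep_vars (\<lambda>_. borel) X {..<G}" and "G > 0"
    and S: "S \<in> sets borel"
    and q: "\<And>g. g < G \<Longrightarrow> prob {\<omega>\<in>space M. X g \<omega> \<in> S} \<le> q" "q \<le> 1"
  shows "prob {\<omega>\<in>space M. G \<le> 2 * card {g. g < G \<and> X g \<omega> \<in> S}} \<le> (2 * sqrt q) ^ G"
proof -
  have rv[measurable]: "random_variable borel (X g)" if "g < G" for g
    using ind that by (auto simp: indep_vars_def)
  note S[measurable]
  have q0: "0 \<le> q" using q(1)[of 0] \<open>G > 0\<close> by (meson measure_nonneg order_trans)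
  define \<J> where "\<J> = {J. J \<subseteq> {..<G} \<and> G \<le> 2 * card J}"
  define E where "E J = (\<Inter>g\<in>J. X g -` S \<inter> space M)" for J
  have fin: "finite \<J>" unfolding \<J>_def by (rule finite_subset[of _ "Pow {..<G}"]) auto
  have ne: "J \<noteq> {}" "finite J" "J \<subseteq> {..<G}" if "J \<in> \<J>" for J
    using that \<open>G > 0\<close> finite_subset[of J "{..<G}"] unfolding \<J>_def by auto
  have Ein: "E J \<in> events" if "J \<in> \<J>" for J
    unfolding E_def using ne[OF that] rv by (intro sets.finite_INT) (auto intro: measurable_sets)
  have PE: "prob (E J) \<le> sqrt q ^ G" if "J \<in> \<J>" for J
  proof -
    have "prob (E J) = (\<Prod>g\<in>J. prob (X g -` S \<inter> space M))"
      unfolding E_def by (rule indep_varsD[OF ind ne[OF that]]) auto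
    also have "\<dots> \<le> (\<Prod>g\<in>J. q)"
      using q(1) ne[OF that] by (intro prod_mono) (auto simp: vimage_def Int_def conj_commute)
    also have "\<dots> = sqrt q ^ (2 * card J)"
      using q0 by (simp add: power_mult)
    also have "\<dots> \<le> sqrt q ^ G"
      using that q q0 by (intro power_decreasing) (auto simp: \<J>_def)
    finally show ?thesis .
  qed
  have "{\<omega>\<in>space M. G \<le> 2 * card {g. g < G \<and> X g \<omega> \<in> S}} \<subseteq> (\<Union>J\<in>\<J>. E J)"
  proof
    fix \<omega> assume *: "\<omega> \<in> {\<omega>\<in>space M. G \<le> 2 * card {g. g < G \<and> X g \<omega> \<in> S}}"
    then have "{g. g < G \<and> X g \<omega> \<in> S} \<in> \<J>" by (auto simp: \<J>_def)
    moreover have "\<omega> \<in> E {g. g < G \<and> X g \<omega> \<in> S}" using * by (auto simp: E_def)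
    ultimately show "\<omega> \<in> (\<Union>J\<in>\<J>. E J)" by blast
  qed
  then have "prob {\<omega>\<in>space M. G \<le> 2 * card {g. g < G \<and> X g \<omega> \<in> S}} \<le> prob (\<Union>J\<in>\<J>. E J)"
    using fin Ein by (intro finite_measure_mono) auto
  also have "\<dots> \<le> (\<Sum>J\<in>\<J>. prob (E J))"
    using fin Ein by (intro finite_measure_subadditive_finite) auto
  also have "\<dots> \<le> card \<J> * sqrt q ^ G"
    using sum_bounded_above[of \<J> "\<lambda>J. prob (E J)" "sqrt q ^ G"] PE by simp
  also have "\<dots> \<le> 2 ^ G * sqrt q ^ G"
  proof -
    have "card \<J> \<le> card (Pow {..<G})" by (rule card_mono) (auto simp: \<J>_def)
    then have "real (card \<J>) \<le> 2 ^ G" by (simp add: card_Pow)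
    then show ?thesis using q0 by (intro mult_right_mono) auto
  qed
  finally show ?thesis by (simp add: power_mult_distrib)
qed

end

section \<open>The test\<close>

definition block :: "nat \<Rightarrow> nat \<Rightarrow> nat \<Rightarrow> nat set" where
  "block v m b = {v + b * m<..v + (b + 1) * m} \<union> {v - (b + 1) * m<..v - b * m}"

definition side :: "nat \<Rightarrow> nat \<Rightarrow> real" where
  "side v t = (if v < t then 1 else - 1)"

definition group_stat :: "nat \<Rightarrow> nat \<Rightarrow> nat \<Rightarrow> nat \<Rightarrow> (nat \<times> nat \<Rightarrow> real) \<Rightarrow> real" where
  "group_stat p v m g X =
     (\<Sum>j\<in>{1..p}. (\<Sum>t\<in>block v m (2 * g). side v t * X (j, t)) *
                   (\<Sum>t\<in>block v m (2 * g + 1). side v t * X (j, t)))"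

definition admissible :: "nat \<Rightarrow> nat \<Rightarrow> nat \<Rightarrow> nat \<Rightarrow> bool" where
  "admissible n G v m \<longleftrightarrow> 1 \<le> m \<and> 2 * G * m \<le> v \<and> v + 2 * G * m \<le> n"

definition majority :: "nat \<Rightarrow> nat \<Rightarrow> nat \<Rightarrow> nat \<Rightarrow> real set \<Rightarrow> (nat \<times> nat \<Rightarrow> real) \<Rightarrow> bool" where
  "majority p G v m S X \<longleftrightarrow> G \<le> 2 * card {g. g < G \<and> group_stat p v m g X \<in> S}"

text \<open>
  Comparing the median of the group statistics with a threshold is encoded by counting. The group
  statistics use sums instead of means, which scales the threshold by \<open>m\<^sup>2\<close>.
\<close>

definition mom_test :: "nat \<Rightarrow> nat \<Rightarrow> nat \<Rightarrow> real \<Rightarrow> (nat \<times> nat \<Rightarrow> real) \<Rightarrow> real" where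
  "mom_test p n G c X =
     of_bool (\<exists>v\<in>{..n}. \<exists>m\<in>{..n}. admissible n G v m \<and> majority p G v m {c * m * sqrt p..} X)"

definition shift :: "nat \<Rightarrow> nat \<Rightarrow> (nat \<times> nat \<Rightarrow> real) \<Rightarrow> (nat \<times> nat \<Rightarrow> real) \<Rightarrow> nat \<times> nat \<Rightarrow> real" where
  "shift p n \<theta> E = (\<lambda>e\<in>entries p n. \<theta> e + E e)"

lemma block_bounds:
  assumes "admissible n G v m" "b < 2 * G"
  shows "(b + 1) * m \<le> v" "v + (b + 1) * m \<le> n"
proof -
  have "(b + 1) * m \<le> 2 * G * m" using assms(2) by (intro mult_right_mono) auto
  then show "(b + 1) * m \<le> v" "v + (b + 1) * m \<le> n"
    using assms(1) unfolding admissible_def by linarith+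
qed

lemma block_subset:
  assumes "admissible n G v m" "b < 2 * G"
  shows "block v m b \<subseteq> {1..n}"
proof -
  have "b * m \<le> (b + 1) * m" by simp
  with block_bounds[OF assms] show ?thesis unfolding block_def by auto
qed

lemma finite_block: "finite (block v m b)"
  by (simp add: block_def)

lemma card_block:
  assumes "(b + 1) * m \<le> v"
  shows "card (block v m b) = 2 * m"
  using assms unfolding block_def by (subst card_Un_disjoint) (auto simp: algebra_simps)

lemma sum_side_block:
  fixes x y :: real
  assumes b: "(b + 1) * m \<le> v"
    and right: "\<And>t. t \<in> {v + b * m<..v + (b + 1) * m} \<Longrightarrow> f t = x"
    and left: "\<And>t. t \<in> {v - (b + 1) * m<..v - b * m} \<Longrightarrow> f t = y"
  shows "(\<Sum>t\<in>block v m b. side v t * f t) = real m * (x - y)"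
proof -
  have "(\<Sum>t\<in>block v m b. side v t * f t) =
      (\<Sum>t\<in>{v + b * m<..v + (b + 1) * m}. side v t * f t) +
      (\<Sum>t\<in>{v - (b + 1) * m<..v - b * m}. side v t * f t)"
    unfolding block_def by (rule sum.union_disjoint) auto
  also have "(\<Sum>t\<in>{v + b * m<..v + (b + 1) * m}. side v t * f t) =
      (\<Sum>t\<in>{v + b * m<..v + (b + 1) * m}. x)"
    using right by (intro sum.cong) (auto simp: side_def)
  also have "(\<Sum>t\<in>{v - (b + 1) * m<..v - b * m}. side v t * f t) =
      (\<Sum>t\<in>{v - (b + 1) * m<..v - b * m}. - y)"
    using left by (intro sum.cong) (auto simp: side_def)
  finally show ?thesis using b by (simp add: algebra_simps)
qed

lemma block_disjoint:
  assumes "(b + 1) * m \<le> v" "(b' + 1) * m \<le> v" "b \<noteq> b'"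
  shows "block v m b \<inter> block v m b' = {}"
proof -
  have *: "block v m b \<inter> block v m b' = {}" if "b < b'" for b b'
  proof -
    have "(b + 1) * m \<le> b' * m" using that by (intro mult_right_mono) auto
    then show ?thesis unfolding block_def by auto
  qed
  show ?thesis using *[of b b'] *[of b' b] assms(3) by (cases b b' rule: linorder_cases) auto
qed

lemma measurable_coord:
  "e \<in> entries p n \<Longrightarrow> (\<lambda>X. X e) \<in> borel_measurable (matrix_space p n)"
  unfolding matrix_space_def by measurable

lemma measurable_group_stat:
  assumes "admissible n G v m" "g < G"
  shows "group_stat p v m g \<in> borel_measurable (matrix_space p n)"
proof -
  have "block v m (2 * g) \<subseteq> {1..n}" "block v m (2 * g + 1) \<subseteq> {1..n}"
    using block_subset[OF assms(1), of "2 * g"] block_subset[OF assms(1), of "2 * g + 1"] assms(2)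
    by simp_all
  then have coord: "(\<lambda>X. X (j, t)) \<in> borel_measurable (matrix_space p n)"
    if "j \<in> {1..p}" "t \<in> block v m (2 * g) \<union> block v m (2 * g + 1)" for j t
    using that by (intro measurable_coord) (auto simp: entries_def)
  show ?thesis unfolding group_stat_def[abs_def]
    by (rule borel_measurable_sum, rule borel_measurable_times;
        rule borel_measurable_sum, rule borel_measurable_times[OF borel_measurable_const coord]; simp)
qed

lemma majority_sets:
  assumes "admissible n G v m" "S \<in> sets borel"
  shows "{X\<in>space (matrix_space p n). majority p G v m S X} \<in> sets (matrix_space p n)"
proof -
  let ?M = "matrix_space p n"
  have "{X\<in>space ?M. g \<in> {g. g < G \<and> group_stat p v m g X \<in> S}} \<in> sets ?M" for g
  proof (cases "g < G")
    case True
    have "group_stat p v m g -` S \<inter> space ?M \<in> sets ?M"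
      using measurable_sets[OF measurable_group_stat[OF assms(1) True] assms(2)] .
    also have "group_stat p v m g -` S \<inter> space ?M =
        {X\<in>space ?M. g \<in> {g. g < G \<and> group_stat p v m g X \<in> S}}"
      using True by blast
    finally show ?thesis .
  qed simp
  then have "(\<lambda>X. card {g. g < G \<and> group_stat p v m g X \<in> S}) \<in> measurable ?M (count_space UNIV)"
    by (rule measurable_card)
  then have "(\<lambda>X. card {g. g < G \<and> group_stat p v m g X \<in> S}) -` {x. G \<le> 2 * x} \<inter> space ?M \<in> sets ?M"
    by (rule measurable_sets) simp
  also have "(\<lambda>X. card {g. g < G \<and> group_stat p v m g X \<in> S}) -` {x. G \<le> 2 * x} \<inter> space ?M =
      {X\<in>space ?M. majority p G v m S X}"
    unfolding majority_def by blast
  finally show ?thesis .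
qed

lemma mom_test_in_tests: "mom_test p n G c \<in> tests p n"
proof -
  let ?M = "matrix_space p n"
  have "{X\<in>space ?M. admissible n G v m \<and> majority p G v m {c * m * sqrt p..} X} \<in> sets ?M" for v m
    using majority_sets[of n G v m "{c * m * sqrt p..}" p] by (cases "admissible n G v m") simp_all
  then have *: "{X\<in>space ?M. \<exists>v\<in>{..n}. \<exists>m\<in>{..n}. admissible n G v m \<and>
      majority p G v m {c * m * sqrt p..} X} \<in> sets ?M"
    by (intro sets.sets_Collect_finite_Ex) auto
  show ?thesis unfolding tests_def mom_test_def[abs_def] of_bool_def
    by (rule measurable_If) (use * in auto)
qed

lemma noise_moments:
  assumes P: "P \<in> noise_laws p n \<alpha> K" and e: "e \<in> entries p n"
  shows "integrable P (\<lambda>E. (E e)\<^sup>2)" "(LINT E|P. E e) = 0" "(LINT E|P. (E e)\<^sup>2) = 1"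
proof -
  have s: "sets P = sets (matrix_space p n)" using P by (simp add: noise_laws_def)
  have [measurable]: "(\<lambda>E. E e) \<in> borel_measurable P"
    using measurable_coord[OF e] measurable_cong_sets[OF s refl] by blast
  have "distr P borel (\<lambda>E. E e) \<in> noise_class \<alpha> K" using P e by (simp add: noise_laws_def)
  then show "integrable P (\<lambda>E. (E e)\<^sup>2)" "(LINT E|P. E e) = 0" "(LINT E|P. (E e)\<^sup>2) = 1"
    by (auto simp: noise_class_def integral_distr integrable_distr_eq)
qed

lemma measurable_shift: "shift p n \<theta> \<in> measurable (matrix_space p n) (matrix_space p n)"
  unfolding shift_def[abs_def] matrix_space_def by measurable

lemma majority_prob_le:
  fixes u :: "nat \<Rightarrow> real"
  assumes P: "P \<in> noise_laws p n \<alpha> K" and adm: "admissible n G v m" and "G > 0"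
    and \<theta>: "\<And>b j. b < 2 * G \<Longrightarrow> j \<in> {1..p} \<Longrightarrow> (\<Sum>t\<in>block v m b. side v t * \<theta> (j, t)) = u j"
    and S: "S \<in> sets borel" and "r > 0" and Sr: "\<And>x. x \<in> S \<Longrightarrow> r \<le> \<bar>x - (\<Sum>j\<in>{1..p}. (u j)\<^sup>2)\<bar>"
    and q: "(4 * real m * (\<Sum>j\<in>{1..p}. (u j)\<^sup>2) + 4 * (real m)\<^sup>2 * real p) / r\<^sup>2 \<le> q" "q \<le> 1"
  shows "measure P {E\<in>space P. majority p G v m S (shift p n \<theta> E)} \<le> (2 * sqrt q) ^ G"
proof -
  interpret P: prob_space P using P by (simp add: noise_laws_def)
  have ind: "P.indep_vars (\<lambda>_. borel) (\<lambda>e E. E e) (entries p n)"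
    using P by (simp add: noise_laws_def)
  define T where "T g E = (\<Sum>j\<in>{1..p}. (u j + (\<Sum>t\<in>block v m (2 * g). side v t * E (j, t))) *
      (u j + (\<Sum>t\<in>block v m (2 * g + 1). side v t * E (j, t))))" for g and E :: "nat \<times> nat \<Rightarrow> real"
  have T_eq: "group_stat p v m g (shift p n \<theta> E) = T g E" if "g < G" for g E
  proof -
    have "(\<Sum>t\<in>block v m b. side v t * shift p n \<theta> E (j, t)) =
        u j + (\<Sum>t\<in>block v m b. side v t * E (j, t))" if "b < 2 * G" "j \<in> {1..p}" for b j
    proof -
      have "(\<Sum>t\<in>block v m b. side v t * shift p n \<theta> E (j, t)) =
          (\<Sum>t\<in>block v m b. side v t * \<theta> (j, t) + side v t * E (j, t))"
        using block_subset[OF adm that(1)] that(2)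
        by (intro sum.cong refl) (auto simp: shift_def entries_def algebra_simps)
      then show ?thesis using \<theta>[OF that] by (simp add: sum.distrib)
    qed
    then show ?thesis using that unfolding group_stat_def T_def by (intro sum.cong) auto
  qed
  define cols where "cols g = block v m (2 * g) \<union> block v m (2 * g + 1)" for g
  have sub: "{1..p} \<times> cols g \<subseteq> entries p n" if "g < G" for g
    using block_subset[OF adm, of "2 * g"] block_subset[OF adm, of "2 * g + 1"] that
    unfolding cols_def entries_def by auto
  have dis: "disjoint_family_on (\<lambda>g. {1..p} \<times> cols g) {..<G}"
  proof -
    have "block v m b \<inter> block v m b' = {}" if "b < 2 * G" "b' < 2 * G" "b \<noteq> b'" for b b'
      using that by (intro block_disjoint block_bounds[OF adm])
    then have "cols g \<inter> cols h = {}" if "g < G" "h < G" "g \<noteq> h" for g h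
    proof -
      have "2 * g + 1 \<noteq> 2 * h" "2 * g \<noteq> 2 * h + 1" by presburger+
      with that show ?thesis
        unfolding cols_def Int_Un_distrib Int_Un_distrib2
        by (simp add: \<open>\<And>b b'. b < 2 * G \<Longrightarrow> b' < 2 * G \<Longrightarrow> b \<noteq> b' \<Longrightarrow> block v m b \<inter> block v m b' = {}\<close>)
    qed
    then show ?thesis unfolding disjoint_family_on_def by (auto simp: Times_Int_Times)
  qed
  have "P.indep_vars (\<lambda>g. PiM ({1..p} \<times> cols g) (\<lambda>_. borel))
      (\<lambda>g E. restrict (\<lambda>e. E e) ({1..p} \<times> cols g)) {..<G}"
    using P.indep_vars_restrict[OF ind _ dis] sub by auto
  then have "P.indep_vars (\<lambda>_. borel) (\<lambda>g E. T g (restrict (\<lambda>e. E e) ({1..p} \<times> cols g))) {..<G}"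
    unfolding T_def cols_def
    by (rule P.indep_vars_compose2)
      (intro borel_measurable_sum borel_measurable_times borel_measurable_add borel_measurable_const
        measurable_component_singleton; simp)
  then have indT: "P.indep_vars (\<lambda>_. borel) T {..<G}"
    unfolding T_def cols_def by simp
  have "P.prob {E\<in>space P. T g E \<in> S} \<le> q" if "g < G" for g
  proof -
    note bb = block_bounds[OF adm, of "2 * g"] block_bounds[OF adm, of "2 * g + 1"]
    have "P.prob {E\<in>space P. T g E \<in> S} \<le> P.prob {E\<in>space P. r \<le> \<bar>T g E - (\<Sum>j\<in>{1..p}. (u j)\<^sup>2)\<bar>}"
    proof (rule P.finite_measure_mono)
      have [measurable]: "T g \<in> borel_measurable P" using indT that by (auto simp: P.indep_vars_def)
      show "{E\<in>space P. r \<le> \<bar>T g E - (\<Sum>j\<in>{1..p}. (u j)\<^sup>2)\<bar>} \<in> P.events" by measurable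
    qed (use Sr in auto)
    also have "\<dots> \<le> (2 * real (2 * m) * (\<Sum>j\<in>{1..p}. (u j)\<^sup>2) + (real (2 * m))\<^sup>2 * card {1..p}) / r\<^sup>2"
      unfolding T_def
    proof (rule P.inner_product_of_signed_sums_tail)
      show "P.indep_vars (\<lambda>_. borel) (\<lambda>e E. E e) ({1..p} \<times> (block v m (2 * g) \<union> block v m (2 * g + 1)))"
        using P.indep_vars_subset[OF ind sub[OF that]] by (simp add: cols_def)
    qed (use that bb sub[OF that] noise_moments[OF P] \<open>r > 0\<close> in
        \<open>auto simp: finite_block card_block block_disjoint cols_def side_def\<close>)
    also have "\<dots> \<le> q" using q(1) by (simp add: power_mult_distrib)
    finally show ?thesis .
  qed
  from P.indep_vars_majority[OF indT \<open>G > 0\<close> S this q(2)] show ?thesis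
    unfolding majority_def using T_eq by (simp cong: conj_cong)
qed

lemma data_law_integral:
  assumes P: "P \<in> noise_laws p n \<alpha> K" and \<phi>: "\<phi> \<in> tests p n"
  shows "(LINT X|data_law p n \<theta> P. \<phi> X) = measure P {E\<in>space P. \<phi> (shift p n \<theta> E) = 1}"
    and "(LINT X|data_law p n \<theta> P. 1 - \<phi> X) = measure P {E\<in>space P. \<phi> (shift p n \<theta> E) = 0}"
proof -
  interpret P: prob_space P using P by (simp add: noise_laws_def)
  have s: "sets P = sets (matrix_space p n)" using P by (simp add: noise_laws_def)
  have sh[measurable]: "shift p n \<theta> \<in> measurable P (matrix_space p n)"
    using measurable_shift measurable_cong_sets[OF s refl] by blast
  have phi[measurable]: "\<phi> \<in> measurable (matrix_space p n) (count_space {0, 1})"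
    using \<phi> by (simp add: tests_def)
  have borel[measurable]: "\<phi> \<in> borel_measurable (matrix_space p n)"
    using measurable_comp[OF phi, of "\<lambda>x. x" borel] by (simp add: comp_def)
  have val: "\<phi> (shift p n \<theta> E) \<in> {0, 1}" if "E \<in> space P" for E
    using measurable_space[OF phi measurable_space[OF sh that]] by simp
  have law: "data_law p n \<theta> P = distr P (matrix_space p n) (shift p n \<theta>)"
    by (simp add: data_law_def shift_def[abs_def])
  have ind: "(LINT E|P. indicator A E) = measure P A" if "A \<in> sets P" for A
    using that by simp
  have "(LINT X|data_law p n \<theta> P. \<phi> X) = (LINT E|P. \<phi> (shift p n \<theta> E))"
    unfolding law by (intro integral_distr) measurable
  also have "\<dots> = (LINT E|P. indicator {E\<in>space P. \<phi> (shift p n \<theta> E) = 1} E)"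
    by (intro Bochner_Integration.integral_cong) (use val in \<open>auto simp: indicator_def\<close>)
  finally show "(LINT X|data_law p n \<theta> P. \<phi> X) = measure P {E\<in>space P. \<phi> (shift p n \<theta> E) = 1}"
    by (subst (asm) ind) measurable
  have "(LINT X|data_law p n \<theta> P. 1 - \<phi> X) = (LINT E|P. 1 - \<phi> (shift p n \<theta> E))"
    unfolding law by (intro integral_distr) measurable
  also have "\<dots> = (LINT E|P. indicator {E\<in>space P. \<phi> (shift p n \<theta> E) = 0} E)"
    by (intro Bochner_Integration.integral_cong) (use val in \<open>auto simp: indicator_def\<close>)
  finally show "(LINT X|data_law p n \<theta> P. 1 - \<phi> X) = measure P {E\<in>space P. \<phi> (shift p n \<theta> E) = 0}"
    by (subst (asm) ind) measurable
qed

section \<open>Error probabilities\<close>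

lemma change_points_adjacent:
  assumes "\<tau> \<in> change_points n k" "i \<in> {1..k}"
  shows "\<tau> (i + 1) \<le> n"
proof (cases "i = k")
  case True
  then show ?thesis using assms by (simp add: change_points_def)
next
  case False
  then have "\<tau> (i + 1) \<le> \<tau> k"
    using assms by (intro strict_mono_on_leD[of "{1..k}" \<tau>]) (auto simp: change_points_def)
  then show ?thesis using assms by (auto simp: change_points_def)
qed

lemma Theta_multi_window:
  assumes \<theta>: "\<theta> \<in> Theta_multi p n \<rho>" and n: "1 \<le> ln (real n)"
    and \<rho>: "C * sqrt p * ln n \<le> \<rho>\<^sup>2"
  defines "G \<equiv> nat \<lceil>ln (real n)\<rceil>"
  shows "\<exists>v m. \<exists>\<delta> :: nat \<Rightarrow> real. admissible n G v m \<and>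
    (\<forall>b<2 * G. \<forall>j\<in>{1..p}. (\<Sum>t\<in>block v m b. side v t * \<theta> (j, t)) = m * \<delta> j) \<and>
    C / 8 * sqrt p \<le> m * (\<Sum>j\<in>{1..p}. (\<delta> j)\<^sup>2)"
proof -
  from \<theta> obtain k \<tau> \<mu> i where \<tau>: "\<tau> \<in> change_points n k" and i: "i \<in> {1..k}"
    and \<mu>: "\<And>i t j. i \<in> {1..k + 1} \<Longrightarrow> t \<in> {\<tau> (i - 1) + 1..\<tau> i} \<Longrightarrow> j \<in> {1..p} \<Longrightarrow> \<theta> (j, t) = \<mu> i j"
    and long: "4 * ln (real n) \<le> real (spacing \<tau> i)"
    and strong: "\<rho>\<^sup>2 \<le> (jump p \<mu> i)\<^sup>2 * real (spacing \<tau> i)"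
    unfolding Theta_multi_def Theta_at_def by fast
  define s where "s = spacing \<tau> i"
  define m where "m = s div (2 * G)"
  define \<delta> where "\<delta> j = \<mu> (i + 1) j - \<mu> i j" for j
  have "real G = \<lceil>ln (real n)\<rceil>" unfolding G_def using n by (intro of_nat_nat) linarith
  then have G: "ln n \<le> G" "G \<le> 2 * ln n" using n by linarith+
  have G0: "G > 0" using G n by linarith
  have "real (2 * G) \<le> real s" using G long unfolding s_def by simp
  then have "2 * G \<le> s" by linarith
  then have m1: "1 \<le> m" unfolding m_def using G0 by (simp add: Suc_le_eq div_greater_zero_iff)
  have Gm: "2 * G * m \<le> s" unfolding m_def by simp
  have "s > 0" using \<open>2 * G \<le> s\<close> G0 by linarith
  then have win: "\<tau> (i - 1) + s \<le> \<tau> i" "\<tau> i + s \<le> \<tau> (i + 1)"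
    unfolding s_def spacing_def by auto
  have adm: "admissible n G (\<tau> i) m"
    unfolding admissible_def using m1 Gm win change_points_adjacent[OF \<tau> i] by linarith
  have sums: "(\<Sum>t\<in>block (\<tau> i) m b. side (\<tau> i) t * \<theta> (j, t)) = m * \<delta> j"
    if "b < 2 * G" and j: "j \<in> {1..p}" for b j
  proof -
    have "(b + 1) * m \<le> 2 * G * m" using that by (intro mult_right_mono) auto
    then have bs: "(b + 1) * m \<le> s" using Gm by linarith
    have "b * m \<le> (b + 1) * m" by simp
    show ?thesis unfolding \<delta>_def
    proof (rule sum_side_block)
      show "(b + 1) * m \<le> \<tau> i" using bs win by linarith
      show "\<theta> (j, t) = \<mu> (i + 1) j" if "t \<in> {\<tau> i + b * m<..\<tau> i + (b + 1) * m}" for t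
        using that bs win i j by (intro \<mu>) auto
      show "\<theta> (j, t) = \<mu> i j" if "t \<in> {\<tau> i - (b + 1) * m<..\<tau> i - b * m}" for t
      proof (rule \<mu>)
        have "\<tau> (i - 1) < t" "t \<le> \<tau> i" using that bs win by auto
        then show "t \<in> {\<tau> (i - 1) + 1..\<tau> i}" by simp
      qed (use i j in auto)
    qed
  qed
  let ?D = "\<Sum>j\<in>{1..p}. (\<delta> j)\<^sup>2"
  have D: "(jump p \<mu> i)\<^sup>2 = ?D" and D0: "0 \<le> ?D"
    unfolding jump_def L2_set_def \<delta>_def by (simp_all add: sum_nonneg)
  have "s < 2 * G * (m + 1)"
    unfolding m_def using G0 by (metis Suc_eq_plus1 dividend_less_times_div mult_Suc_right add.commute nat_0_less_mult_iff zero_less_numeral)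
  also have "\<dots> \<le> 2 * G * (2 * m)" using m1 by (intro mult_left_mono) auto
  finally have "s \<le> 4 * G * m" by simp
  then have "real s \<le> real (4 * G * m)" by linarith
  also have "\<dots> = 4 * real G * real m" by simp
  also have "\<dots> \<le> 4 * (2 * ln n) * real m" using G by (intro mult_right_mono) auto
  finally have sm: "real s \<le> 8 * ln n * m" by simp
  have "C * sqrt p * ln n \<le> ?D * s" using \<rho> strong D by (simp add: s_def)
  also have "\<dots> \<le> ?D * (8 * ln n * m)" using sm D0 by (rule mult_left_mono)
  finally have "(C * sqrt p) * ln n \<le> (8 * (m * ?D)) * ln n" by (simp add: mult_ac)
  then have "C * sqrt p \<le> 8 * (m * ?D)" using n by (simp add: mult_le_cancel_right)
  then have "C / 8 * sqrt p \<le> m * ?D" by simp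
  with adm sums show ?thesis by blast
qed

lemma null_majority_prob:
  assumes P: "P \<in> noise_laws p n \<alpha> K" and \<theta>: "\<theta> \<in> Theta_null p n"
    and adm: "admissible n G v m" and "G > 0" "p \<ge> 1" and q: "0 < q" "q \<le> 1"
  shows "measure P {E\<in>space P. majority p G v m {2 / sqrt q * m * sqrt p..} (shift p n \<theta> E)} \<le> (2 * sqrt q) ^ G"
proof -
  from \<theta> obtain \<mu> where \<mu>: "\<And>t j. t \<in> {1..n} \<Longrightarrow> j \<in> {1..p} \<Longrightarrow> \<theta> (j, t) = \<mu> j"
    unfolding Theta_null_def by blast
  have m: "m > 0" using adm by (simp add: admissible_def)
  show ?thesis
  proof (rule majority_prob_le[OF P adm \<open>G > 0\<close>, where u = "\<lambda>_. 0" and r = "2 / sqrt q * m * sqrt p"])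
    fix b j assume b: "b < 2 * G" and j: "j \<in> {1..p}"
    have sub: "block v m b \<subseteq> {1..n}" using block_subset[OF adm b] .
    have "(\<Sum>t\<in>block v m b. side v t * \<theta> (j, t)) = real m * (\<mu> j - \<mu> j)"
      using sub \<mu> j by (intro sum_side_block block_bounds(1)[OF adm b]) (auto simp: block_def)
    then show "(\<Sum>t\<in>block v m b. side v t * \<theta> (j, t)) = 0" by simp
  next
    have "4 * (real m)\<^sup>2 * real p / (2 / sqrt q * m * sqrt p)\<^sup>2 = q"
      using m \<open>p \<ge> 1\<close> q by (simp add: power_mult_distrib power_divide)
    then show "(4 * real m * (\<Sum>j\<in>{1..p}. (0::real)\<^sup>2) + 4 * (real m)\<^sup>2 * real p) / (2 / sqrt q * m * sqrt p)\<^sup>2 \<le> q"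
      by simp
  qed (use m \<open>p \<ge> 1\<close> q in auto)
qed

lemma alternative_majority_prob:
  fixes \<delta> :: "nat \<Rightarrow> real"
  assumes P: "P \<in> noise_laws p n \<alpha> K" and adm: "admissible n G v m" and "G > 0" "p \<ge> 1"
    and \<theta>: "\<And>b j. b < 2 * G \<Longrightarrow> j \<in> {1..p} \<Longrightarrow>
       (\<Sum>t\<in>block v m b. side v t * \<theta> (j, t)) = m * \<delta> j"
    and q: "0 < q" "q \<le> 1"
    and \<delta>: "32 / q * sqrt p \<le> m * (\<Sum>j\<in>{1..p}. (\<delta> j)\<^sup>2)"
  shows "measure P {E\<in>space P. majority p G v m {..<2 / sqrt q * m * sqrt p} (shift p n \<theta> E)} \<le> (2 * sqrt q) ^ G"
proof -
  define Y where "Y = real m * (\<Sum>j\<in>{1..p}. (\<delta> j)\<^sup>2)"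
  have m: "real m > 0" using adm by (simp add: admissible_def)
  have p1: "1 \<le> sqrt p" using \<open>p \<ge> 1\<close> by simp
  have "32 / q > 0" using q by simp
  have U: "(\<Sum>j\<in>{1..p}. (m * \<delta> j)\<^sup>2) = m * Y"
    unfolding Y_def by (simp add: power_mult_distrib sum_distrib_left power2_eq_square mult_ac)
  have "q\<^sup>2 \<le> q" using q by (simp add: power2_eq_square mult_left_le)
  then have "q \<le> sqrt q" using q real_le_rsqrt by blast
  then have "4 / sqrt q \<le> 4 / q" using q by (intro divide_left_mono) auto
  also have "\<dots> \<le> 32 / q" using q by (intro divide_right_mono) auto
  finally have "4 / sqrt q * sqrt p \<le> 32 / q * sqrt p" using p1 by (intro mult_right_mono) auto
  then have thr: "4 / sqrt q * sqrt p \<le> Y" using \<delta> unfolding Y_def by linarith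
  have "q * (32 / q * sqrt p) \<le> q * Y" using \<delta> q unfolding Y_def by (intro mult_left_mono) auto
  then have Yp: "32 * sqrt p \<le> q * Y" using q by simp
  then have Y32: "32 \<le> q * Y" using p1 by linarith
  then have "q * Y > 0" by linarith
  then have Y0: "Y > 0" using q by (simp add: zero_less_mult_iff)
  show ?thesis
  proof (rule majority_prob_le[OF P adm \<open>G > 0\<close> \<theta>, where r = "m * Y / 2"])
    show "m * Y / 2 > 0" using m Y0 by simp
    show "m * Y / 2 \<le> \<bar>x - (\<Sum>j\<in>{1..p}. (m * \<delta> j)\<^sup>2)\<bar>" if "x \<in> {..<2 / sqrt q * m * sqrt p}" for x
    proof -
      have "m * (4 / sqrt q * sqrt p) \<le> m * Y" using thr m by (intro mult_left_mono) auto
      moreover have "m * (4 / sqrt q * sqrt p) = 2 * (2 / sqrt q * m * sqrt p)" by simp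
      moreover have "x < 2 / sqrt q * m * sqrt p" using that by simp
      ultimately have "x \<le> m * Y / 2" by linarith
      then show ?thesis unfolding U by linarith
    qed
    have "(32 * sqrt p)\<^sup>2 \<le> (q * Y)\<^sup>2" using Yp p1 by (intro power_mono) auto
    moreover have "(32 * sqrt p)\<^sup>2 = 1024 * p" by (simp add: power_mult_distrib)
    moreover have "(q * Y)\<^sup>2 = q * (q * Y\<^sup>2)" by (simp add: power2_eq_square)
    ultimately have "1024 * p \<le> q * (q * Y\<^sup>2)" by simp
    also have "\<dots> \<le> 1 * (q * Y\<^sup>2)" using q by (intro mult_right_mono) auto
    finally have a: "16 * p \<le> q * Y\<^sup>2 / 2" by simp
    have "32 * Y \<le> q * Y * Y" using Y32 Y0 by (intro mult_right_mono) auto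
    then have b: "16 * Y \<le> q * Y\<^sup>2 / 2" by (simp add: power2_eq_square)
    have "16 * Y + 16 * p \<le> q * Y\<^sup>2" using a b by linarith
    then have "(16 * Y + 16 * p) / Y\<^sup>2 \<le> q" using Y0 by (simp add: pos_divide_le_eq)
    moreover have "(4 * real m * (m * Y) + 4 * (real m)\<^sup>2 * real p) / (m * Y / 2)\<^sup>2 = (16 * Y + 16 * p) / Y\<^sup>2"
    proof -
      have "(4 * real m * (m * Y) + 4 * (real m)\<^sup>2 * real p) / (m * Y / 2)\<^sup>2 =
          ((real m)\<^sup>2 * (16 * Y + 16 * p)) / ((real m)\<^sup>2 * Y\<^sup>2)"
        by (simp add: power_mult_distrib power_divide power2_eq_square algebra_simps)
      then show ?thesis using m by simp
    qed
    ultimately show "(4 * real m * (\<Sum>j\<in>{1..p}. (m * \<delta> j)\<^sup>2) + 4 * (real m)\<^sup>2 * real p) / (m * Y / 2)\<^sup>2 \<le> q"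
      unfolding U by simp
  qed (use q in auto)
qed

lemma shift_in_space: "shift p n \<theta> E \<in> space (matrix_space p n)"
  by (auto simp: shift_def matrix_space_def space_PiM)

lemma majority_shift_sets:
  assumes P: "P \<in> noise_laws p n \<alpha> K" and "admissible n G v m" "S \<in> sets borel"
  shows "{E\<in>space P. majority p G v m S (shift p n \<theta> E)} \<in> sets P"
proof -
  have s: "sets P = sets (matrix_space p n)" using P by (simp add: noise_laws_def)
  have "shift p n \<theta> \<in> measurable P (matrix_space p n)"
    using measurable_shift measurable_cong_sets[OF s refl] by blast
  from measurable_sets[OF this majority_sets[OF assms(2,3), of p]] show ?thesis
    by (rule back_subst[where P = "\<lambda>A. A \<in> sets P"]) (use shift_in_space in auto)
qed

lemma mom_test_null_error:
  assumes P: "P \<in> noise_laws p n \<alpha> K" and \<theta>: "\<theta> \<in> Theta_null p n"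
    and "G > 0" "p \<ge> 1" "0 < q" "q \<le> 1"
  shows "(LINT X|data_law p n \<theta> P. mom_test p n G (2 / sqrt q) X) \<le> (real n)\<^sup>2 * (2 * sqrt q) ^ G"
proof -
  interpret P: prob_space P using P by (simp add: noise_laws_def)
  let ?E = "\<lambda>(v, m). {E\<in>space P. majority p G v m {2 / sqrt q * m * sqrt p..} (shift p n \<theta> E)}"
  define W where "W = {(v, m). admissible n G v m}"
  have "W \<subseteq> {1..n} \<times> {1..n}"
  proof safe
    fix v m assume "(v, m) \<in> W"
    then have vm: "1 \<le> m" "2 * G * m \<le> v" "v + 2 * G * m \<le> n" by (auto simp: W_def admissible_def)
    moreover have "m \<le> 2 * G * m" using \<open>G > 0\<close> by simp
    ultimately show "v \<in> {1..n}" "m \<in> {1..n}" unfolding atLeastAtMost_iff by linarith+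
  qed
  then have W: "finite W" "card W \<le> n * n"
    using card_mono[of "{1..n} \<times> {1..n}" W] by (auto intro: finite_subset simp: card_cartesian_product)
  have ev: "?E w \<in> P.events" if "w \<in> W" for w
    using that majority_shift_sets[OF P] by (auto simp: W_def)
  have "(LINT X|data_law p n \<theta> P. mom_test p n G (2 / sqrt q) X) =
      P.prob {E\<in>space P. mom_test p n G (2 / sqrt q) (shift p n \<theta> E) = 1}"
    by (rule data_law_integral(1)[OF P mom_test_in_tests])
  also have "\<dots> \<le> P.prob (\<Union>w\<in>W. ?E w)"
    using W ev by (intro P.finite_measure_mono) (auto simp: mom_test_def W_def)
  also have "\<dots> \<le> (\<Sum>w\<in>W. P.prob (?E w))"
    using W ev by (intro P.finite_measure_subadditive_finite) auto
  also have "\<dots> \<le> (\<Sum>w\<in>W. (2 * sqrt q) ^ G)"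
    using null_majority_prob[OF P \<theta> _ assms(3-)] by (intro sum_mono) (auto simp: W_def)
  also have "\<dots> = real (card W) * (2 * sqrt q) ^ G" by simp
  also have "\<dots> \<le> (real n)\<^sup>2 * (2 * sqrt q) ^ G"
  proof (rule mult_right_mono)
    have "real (card W) \<le> real (n * n)" using W(2) by linarith
    then show "real (card W) \<le> (real n)\<^sup>2" by (simp add: power2_eq_square)
  qed (use \<open>0 < q\<close> in auto)
  finally show ?thesis .
qed

lemma mom_test_alternative_error:
  assumes P: "P \<in> noise_laws p n \<alpha> K" and \<theta>: "\<theta> \<in> Theta_multi p n \<rho>"
    and "p \<ge> 1" "0 < q" "q \<le> 1" and n: "1 \<le> ln (real n)"
    and \<rho>: "256 / q * sqrt p * ln n \<le> \<rho>\<^sup>2"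
  defines "G \<equiv> nat \<lceil>ln (real n)\<rceil>"
  shows "(LINT X|data_law p n \<theta> P. 1 - mom_test p n G (2 / sqrt q) X) \<le> (2 * sqrt q) ^ G"
proof -
  interpret P: prob_space P using P by (simp add: noise_laws_def)
  have "G > 0" using n unfolding G_def by linarith
  obtain v m and \<delta> :: "nat \<Rightarrow> real" where adm: "admissible n G v m"
    and sums: "\<forall>b<2 * G. \<forall>j\<in>{1..p}. (\<Sum>t\<in>block v m b. side v t * \<theta> (j, t)) = m * \<delta> j"
    and "256 / q / 8 * sqrt p \<le> m * (\<Sum>j\<in>{1..p}. (\<delta> j)\<^sup>2)"
    using Theta_multi_window[OF \<theta> n \<rho>] unfolding G_def by blast
  then have big: "32 / q * sqrt p \<le> m * (\<Sum>j\<in>{1..p}. (\<delta> j)\<^sup>2)" by simp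
  have "v \<le> n" "m \<le> n"
  proof -
    have "m \<le> 2 * G * m" using \<open>G > 0\<close> by simp
    with adm show "v \<le> n" "m \<le> n" unfolding admissible_def by linarith+
  qed
  have maj: "majority p G v m {..<2 / sqrt q * m * sqrt p} X"
    if "mom_test p n G (2 / sqrt q) X = 0" for X
  proof -
    let ?R = "{g. g < G \<and> group_stat p v m g X \<in> {2 / sqrt q * m * sqrt p..}}"
    let ?A = "{g. g < G \<and> group_stat p v m g X \<in> {..<2 / sqrt q * m * sqrt p}}"
    have "\<not> majority p G v m {2 / sqrt q * m * sqrt p..} X"
      using that \<open>v \<le> n\<close> \<open>m \<le> n\<close> adm unfolding mom_test_def of_bool_eq_0_iff by blast
    then have "2 * card ?R < G" by (simp add: majority_def)
    moreover have "card ?R + card ?A = card (?R \<union> ?A)"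
      by (intro card_Un_disjoint[symmetric]) auto
    moreover have "?R \<union> ?A = {..<G}" by auto
    ultimately show ?thesis unfolding majority_def by simp
  qed
  have "(LINT X|data_law p n \<theta> P. 1 - mom_test p n G (2 / sqrt q) X) =
      P.prob {E\<in>space P. mom_test p n G (2 / sqrt q) (shift p n \<theta> E) = 0}"
    by (rule data_law_integral(2)[OF P mom_test_in_tests])
  also have "\<dots> \<le> P.prob {E\<in>space P. majority p G v m {..<2 / sqrt q * m * sqrt p} (shift p n \<theta> E)}"
    using maj by (intro P.finite_measure_mono majority_shift_sets[OF P adm]) auto
  also have "\<dots> \<le> (2 * sqrt q) ^ G"
  proof (rule alternative_majority_prob[OF P adm \<open>G > 0\<close> \<open>p \<ge> 1\<close> _ \<open>0 < q\<close> \<open>q \<le> 1\<close> big])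
    show "(\<Sum>t\<in>block v m b. side v t * \<theta> (j, t)) = m * \<delta> j" if "b < 2 * G" "j \<in> {1..p}" for b j
      using sums that by blast
  qed
  finally show ?thesis .
qed

theorem theorem10:
  fixes \<alpha> K \<epsilon> :: real
  assumes "\<alpha> \<ge> 4" and "0 < K" and "0 < \<epsilon>" and "\<epsilon> < 1"
  shows "\<exists>C::real. C > 0 \<and>
    (\<forall>n p :: nat. n \<ge> 50 \<longrightarrow> p \<ge> 1 \<longrightarrow>
      (\<exists>\<phi>\<in>tests p n. \<forall>\<rho>::real. \<rho>\<^sup>2 \<ge> C * sqrt (real p) * ln (real n) \<longrightarrow>
         testing_error p n \<alpha> K \<rho> \<phi> \<le> ennreal \<epsilon>))"
proof -
  define L where "L = ln (2 / \<epsilon>)"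
  define q where "q = (exp (- (L + 2)) / 2)\<^sup>2"
  have L: "0 < L" and expL: "exp (- L) = \<epsilon> / 2"
    unfolding L_def using assms by (simp_all add: exp_minus)
  have sq: "2 * sqrt q = exp (- (L + 2))" unfolding q_def by simp
  have q0: "0 < q" unfolding q_def by simp
  have "exp (- (L + 2)) / 2 \<le> 1" using L by (simp add: order_trans[of _ 1])
  then have q1: "q \<le> 1" unfolding q_def by (intro power_le_one) auto
  show ?thesis
  proof (intro exI[of _ "256 / q"] conjI allI impI)
    show "256 / q > 0" using q0 by simp
  next
    fix n p :: nat assume n50: "n \<ge> 50" and p1: "p \<ge> 1"
    define G where "G = nat \<lceil>ln (real n)\<rceil>"
    have "exp 1 \<le> real n" using exp_le n50 by linarith
    then have n: "1 \<le> ln (real n)" using n50 by (simp add: ln_ge_iff)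
    have G0: "G > 0" and G: "ln n \<le> G" using n unfolding G_def by linarith+
    have "(2 * sqrt q) ^ G = exp (- ((L + 2) * G))" unfolding sq by (simp add: exp_of_nat_mult[symmetric] algebra_simps)
    also have "\<dots> \<le> exp (- ((L + 2) * ln n))" using G L by simp
    also have "\<dots> = exp (- L * ln n) / (real n)\<^sup>2"
    proof -
      have "exp (- ((L + 2) * ln n)) = exp (- L * ln n) * exp (- (2 * ln n))"
        by (simp add: exp_add[symmetric] algebra_simps)
      moreover have "exp (2 * ln n) = (real n)\<^sup>2"
        using n50 exp_of_nat_mult[of 2 "ln (real n)"] by simp
      ultimately show ?thesis by (simp add: exp_minus divide_inverse)
    qed
    also have "\<dots> \<le> (\<epsilon> / 2) / (real n)\<^sup>2"
    proof (rule divide_right_mono)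
      have "L * 1 \<le> L * ln n" using L n by (intro mult_left_mono) auto
      then show "exp (- L * ln n) \<le> \<epsilon> / 2" unfolding expL[symmetric] by simp
    qed simp
    finally have rate: "(real n)\<^sup>2 * (2 * sqrt q) ^ G \<le> \<epsilon> / 2" using n50 by (simp add: field_simps)
    have "1 * (2 * sqrt q) ^ G \<le> (real n)\<^sup>2 * (2 * sqrt q) ^ G"
      using n50 q0 by (intro mult_right_mono) (auto simp: one_le_power)
    then have rate': "(2 * sqrt q) ^ G \<le> \<epsilon> / 2" using rate by linarith
    show "\<exists>\<phi>\<in>tests p n. \<forall>\<rho>::real. \<rho>\<^sup>2 \<ge> 256 / q * sqrt (real p) * ln (real n) \<longrightarrow>
         testing_error p n \<alpha> K \<rho> \<phi> \<le> ennreal \<epsilon>"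
    proof (intro bexI[of _ "mom_test p n G (2 / sqrt q)"] allI impI mom_test_in_tests)
      fix \<rho> :: real assume \<rho>: "\<rho>\<^sup>2 \<ge> 256 / q * sqrt (real p) * ln (real n)"
      have "testing_error p n \<alpha> K \<rho> (mom_test p n G (2 / sqrt q)) \<le> ennreal (\<epsilon> / 2) + ennreal (\<epsilon> / 2)"
        unfolding testing_error_def
      proof (intro add_mono SUP_least ennreal_leI)
        fix P \<theta> assume P: "P \<in> noise_laws p n \<alpha> K"
        show "(LINT X|data_law p n \<theta> P. mom_test p n G (2 / sqrt q) X) \<le> \<epsilon> / 2"
          if "\<theta> \<in> Theta_null p n"
          using mom_test_null_error[OF P that G0 p1 q0 q1] rate by linarith
        show "(LINT X|data_law p n \<theta> P. 1 - mom_test p n G (2 / sqrt q) X) \<le> \<epsilon> / 2"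
          if "\<theta> \<in> Theta_multi p n \<rho>"
          using mom_test_alternative_error[OF P that p1 q0 q1 n \<rho>] rate' unfolding G_def by (rule order_trans)
      qed
      also have "\<dots> = ennreal \<epsilon>" using assms by (simp flip: ennreal_plus)
      finally show "testing_error p n \<alpha> K \<rho> (mom_test p n G (2 / sqrt q)) \<le> ennreal \<epsilon>" .
    qed
  qed
qed

end
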